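(* Let $U$ be a nonempty set, $E$ a finite set, and $G=(F,E)$ a covering soft set over $U$, with associated soft covering approximation space $S=(U,C_G)$. Suppose that for all $e_1,e_2\in E$ the set $F(e_1)\cap F(e_2)$ is a finite union of elements of $C_G$. Then $\tau=\{X\subseteq U: S_-(X)=X\}$ is a topology on $U$.
   Context: A soft set over $U$ is a pair $G=(F,E)$ with $F:E\to P(U)$ a map into the power set of $U$. It is a covering soft set if $\bigcup_{e\in E}F(e)=U$ and $F(e)\neq\emptyset$ for every $e\in E$. Write $C_G=\{F(e):e\in E\}$; the pair $S=(U,C_G)$ is called a soft covering approximation space. For $X\subseteq U$ the soft covering lower approximation is $S_-(X)=\bigcup\{F(e): e\in E,\ F(e)\subseteq X\}$. The empty union (equal to $\emptyset$) counts as a finite union of elements of $C_G$. *)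

theory Defs
  imports "HOL-Analysis.Analysis"
begin

text \<open>
  A soft set \<open>(F, E)\<close> over \<open>U\<close> is given by a HOL function \<open>F\<close> and its parameter set \<open>E\<close>;
  the values of \<open>F\<close> outside \<open>E\<close> are arbitrary and never used.
\<close>

definition soft_set :: "'a set \<Rightarrow> ('e \<Rightarrow> 'a set) \<Rightarrow> 'e set \<Rightarrow> bool" where
  "soft_set U F E \<longleftrightarrow> F \<in> E \<rightarrow> Pow U"

definition covering_soft_set :: "'a set \<Rightarrow> ('e \<Rightarrow> 'a set) \<Rightarrow> 'e set \<Rightarrow> bool" where
  "covering_soft_set U F E \<longleftrightarrow>
     soft_set U F E \<and> (\<Union>e\<in>E. F e) = U \<and> (\<forall>e\<in>E. F e \<noteq> {})"

definition soft_cover :: "('e \<Rightarrow> 'a set) \<Rightarrow> 'e set \<Rightarrow> 'a set set" where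
  "soft_cover F E = {F e | e. e \<in> E}"

definition soft_lower :: "('e \<Rightarrow> 'a set) \<Rightarrow> 'e set \<Rightarrow> 'a set \<Rightarrow> 'a set" where
  "soft_lower F E X = \<Union>{F e | e. e \<in> E \<and> F e \<subseteq> X}"

definition soft_open_sets :: "'a set \<Rightarrow> ('e \<Rightarrow> 'a set) \<Rightarrow> 'e set \<Rightarrow> 'a set set" where
  "soft_open_sets U F E = {X. X \<subseteq> U \<and> soft_lower F E X = X}"

text \<open>
  The library predicate \<^const>\<open>istopology\<close> does not fix the underlying set: it asks for closure
  under binary intersections and arbitrary unions (the empty one included), so \<open>U \<in> \<tau>\<close> has
  to be required separately.
\<close>

definition topology_on :: "'a set \<Rightarrow> 'a set set \<Rightarrow> bool" where
  "topology_on U \<tau> \<longleftrightarrow> \<tau> \<subseteq> Pow U \<and> U \<in> \<tau> \<and> istopology (\<lambda>X. X \<in> \<tau>)"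

end

theory Submission
  imports Defs
begin

text \<open>The members of \<open>soft_cover F E\<close> form a base, and the sets fixed by
  \<open>soft_lower F E\<close> are exactly the unions of base members:
  \<open>soft_lower_eq_iff\<close> turns being fixed into the usual pointwise condition that every
  point of \<open>X\<close> has a basic neighbourhood inside \<open>X\<close>. Covering makes
  \<open>U\<close> open, unions inherit neighbourhoods from their members, and the hypothesis on
  \<open>F e1 \<inter> F e2\<close> is the base axiom that handles binary intersections.\<close>

text \<open>\<open>soft_lower F E X\<close> is always contained in \<open>X\<close>, so only the
  reverse inclusion has content.\<close>

lemma soft_lower_eq_iff:
  "soft_lower F E X = X \<longleftrightarrow> (\<forall>x\<in>X. \<exists>e\<in>E. x \<in> F e \<and> F e \<subseteq> X)"
  unfolding soft_lower_def by blast

text \<open>Basic neighbourhoods of a point in \<open>X\<close> and in \<open>Y\<close> meet in a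
  union of basic sets, one of which contains the point.\<close>

lemma soft_lower_Int_fixed:
  assumes inter: "\<forall>e1\<in>E. \<forall>e2\<in>E. \<exists>D. D \<subseteq> soft_cover F E \<and> F e1 \<inter> F e2 = \<Union>D"
    and X: "soft_lower F E X = X" and Y: "soft_lower F E Y = Y"
  shows "soft_lower F E (X \<inter> Y) = X \<inter> Y"
  unfolding soft_lower_eq_iff
proof
  fix x assume x: "x \<in> X \<inter> Y"
  obtain e1 where e1: "e1 \<in> E" "x \<in> F e1" "F e1 \<subseteq> X"
    using X x unfolding soft_lower_eq_iff by blast
  obtain e2 where e2: "e2 \<in> E" "x \<in> F e2" "F e2 \<subseteq> Y"
    using Y x unfolding soft_lower_eq_iff by blast
  obtain D where D: "D \<subseteq> soft_cover F E" "F e1 \<inter> F e2 = \<Union>D"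
    using inter e1(1) e2(1) by meson
  \<comment> \<open>Since \<open>x\<close> lies in \<open>F e1 \<inter> F e2\<close>, which is
    \<open>\<Union>D\<close>, some member of \<open>D\<close> contains it; this is the basic
    neighbourhood sought.\<close>
  then obtain B where "B \<in> D" "x \<in> B"
    using e1(2) e2(2) by blast
  moreover from this D obtain e where "e \<in> E" "B = F e"
    unfolding soft_cover_def by blast
  moreover have "B \<subseteq> X \<inter> Y"
    using \<open>B \<in> D\<close> D(2) e1(3) e2(3) by blast
  ultimately show "\<exists>e\<in>E. x \<in> F e \<and> F e \<subseteq> X \<inter> Y"
    by blast
qed

lemma soft_lower_Union_fixed:
  assumes "\<And>X. X \<in> K \<Longrightarrow> soft_lower F E X = X"
  shows "soft_lower F E (\<Union>K) = \<Union>K"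
  unfolding soft_lower_eq_iff
proof
  fix x assume "x \<in> \<Union>K"
  then obtain X where X: "X \<in> K" "x \<in> X" by blast
  then obtain e where "e \<in> E" "x \<in> F e" "F e \<subseteq> X"
    using assms[OF X(1)] unfolding soft_lower_eq_iff by blast
  with X(1) show "\<exists>e\<in>E. x \<in> F e \<and> F e \<subseteq> \<Union>K" by blast
qed

theorem theorem24:
  fixes U :: "'a set" and E :: "'e set" and F :: "'e \<Rightarrow> 'a set"
  assumes "U \<noteq> {}"
    and "finite E"
    and "covering_soft_set U F E"
    and "\<forall>e1\<in>E. \<forall>e2\<in>E. \<exists>D. finite D \<and> D \<subseteq> soft_cover F E \<and> F e1 \<inter> F e2 = \<Union>D"
  shows "topology_on U (soft_open_sets U F E)"
proof -
  have inter: "\<forall>e1\<in>E. \<forall>e2\<in>E. \<exists>D. D \<subseteq> soft_cover F E \<and> F e1 \<inter> F e2 = \<Union>D"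
    using assms(4) by meson
  have "soft_lower F E U = U"
    using assms(3) unfolding soft_lower_eq_iff covering_soft_set_def by blast
  moreover have "istopology (\<lambda>X. X \<in> soft_open_sets U F E)"
    unfolding istopology_def
  proof (intro conjI allI impI)
    fix X Y assume "X \<in> soft_open_sets U F E" "Y \<in> soft_open_sets U F E"
    then show "X \<inter> Y \<in> soft_open_sets U F E"
      using soft_lower_Int_fixed[OF inter, of X Y] by (auto simp: soft_open_sets_def)
  next
    \<comment> \<open>\<open>K\<close> may be empty, so this case also yields that the empty set is
      open.\<close>
    fix K assume "\<forall>X\<in>K. X \<in> soft_open_sets U F E"
    then show "\<Union>K \<in> soft_open_sets U F E"
      using soft_lower_Union_fixed[of K F E] by (auto simp: soft_open_sets_def)
  qed
  ultimately show ?thesis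
    unfolding topology_on_def soft_open_sets_def by blast
qed

end
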